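(* Let $A$ be a $C^*$-algebra and let $N_2$ be the set of nilpotent elements of $A$ of order exactly $2$. Then $\overline{\mathrm{span}(N_2)}=\overline{[A,A]}$.
   Context: $N_2=\{x\in A : x^2=0,\ x\neq 0\}$. $[A,A]$ denotes the linear span of all commutators $[x,y]=xy-yx$ with $x,y\in A$. The span is the linear span and the bar denotes norm closure. *)

theory Defs
  imports "HOL-Analysis.Analysis"
begin

text \<open>
  C*-algebras are developed as a type class without unit, so that non-unital algebras (and the
  zero algebra) are included. Building on the real classes gives access to the library's norm,
  topology and completeness; the axiom \<open>scaleR_scaleC\<close> ties the real scalar multiplication to the
  complex one.
\<close>

class complex_vector = real_vector +
  fixes scaleC :: "complex \<Rightarrow> 'a \<Rightarrow> 'a" (infixr "*\<^sub>C" 75)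
  assumes scaleC_add_right: "c *\<^sub>C (x + y) = c *\<^sub>C x + c *\<^sub>C y"
    and scaleC_add_left: "(c + d) *\<^sub>C x = c *\<^sub>C x + d *\<^sub>C x"
    and scaleC_scaleC: "c *\<^sub>C d *\<^sub>C x = (c * d) *\<^sub>C x"
    and scaleC_one: "1 *\<^sub>C x = x"
    and scaleR_scaleC: "r *\<^sub>R x = complex_of_real r *\<^sub>C x"

class complex_algebra = complex_vector + real_algebra +
  assumes mult_scaleC_left: "(c *\<^sub>C x) * y = c *\<^sub>C (x * y)"
    and mult_scaleC_right: "x * (c *\<^sub>C y) = c *\<^sub>C (x * y)"

class complex_normed_algebra = complex_algebra + real_normed_algebra +
  assumes norm_scaleC: "norm (c *\<^sub>C x) = cmod c * norm x"

class cstar_algebra = complex_normed_algebra + banach +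
  fixes star :: "'a \<Rightarrow> 'a"
  assumes star_add: "star (x + y) = star x + star y"
    and star_scaleC: "star (c *\<^sub>C x) = cnj c *\<^sub>C star x"
    and star_mult: "star (x * y) = star y * star x"
    and star_star: "star (star x) = x"
    and cstar_identity: "norm (star x * x) = (norm x)\<^sup>2"

instantiation complex :: cstar_algebra
begin

definition scaleC_complex :: "complex \<Rightarrow> complex \<Rightarrow> complex"
  where "scaleC_complex = (*)"

definition star_complex :: "complex \<Rightarrow> complex"
  where "star_complex = cnj"

instance
  by standard
    (simp_all add: scaleC_complex_def star_complex_def algebra_simps norm_mult
      scaleR_conv_of_real power2_eq_square)

end

global_interpretation complex_vector: vector_space "scaleC :: complex \<Rightarrow> 'a \<Rightarrow> 'a :: complex_vector"
  defines csubspace = complex_vector.subspace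
    and cspan = complex_vector.span
  by standard (simp_all add: scaleC_add_right scaleC_add_left scaleC_scaleC scaleC_one)

text \<open>The square is written as a product because \<open>x\<^sup>2\<close> is only available in unital rings.\<close>

definition nilpotents2 :: "'a :: ring set"
  where "nilpotents2 = {x. x * x = 0 \<and> x \<noteq> 0}"

definition commutator :: "'a :: ring \<Rightarrow> 'a \<Rightarrow> 'a"
  where "commutator x y = x * y - y * x"

definition commutator_span :: "'a :: complex_algebra set"
  where "commutator_span = cspan {commutator x y | x y. True}"

end

theory Submission
  imports Defs "HOL-Complex_Analysis.Complex_Analysis" "HOL-Real_Asymp.Real_Asymp"
begin

text \<open>
  Both inclusions rest on a continuous functional calculus for one self-adjoint element \<open>h\<close>, scaled
  to norm at most 1/2: to a real function \<open>f\<close> that is continuous on \<open>[-1,1]\<close> with \<open>f 0 = 0\<close> it assigns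
  an element \<open>f(h)\<close>, in a linear and multiplicative way and with norm at most the supremum of \<open>\<bar>f\<bar>\<close>.
  The condition \<open>f 0 = 0\<close> is what keeps \<open>f(h)\<close> inside an algebra without unit.

  \<^emph>\<open>The calculus.\<close> By Weierstrass and completeness it suffices to bound \<open>p(h)\<close> for polynomials \<open>p\<close>
  by the supremum of \<open>\<bar>p\<bar>\<close> on \<open>[-1,1]\<close>. For small \<open>h\<close>, left multiplication
  by \<open>h\<close> is the real part of the isometric operator \<open>U = h + \<i> sqrt (1 - h\<^sup>2)\<close>. Substituting
  \<open>h = (U + inverse U) / 2\<close> turns \<open>p(h)\<close> of degree \<open>d\<close> into a Laurent polynomial in \<open>U\<close> with \<open>2 d + 1\<close>
  coefficients, each bounded by the supremum of \<open>\<bar>p\<bar>\<close> through Cauchy's inequality. This gives the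
  desired bound up to the factor \<open>2 d + 1\<close> (\<open>norm_lpoly_le_degree\<close>). The C*-identity
  compares \<open>p\<close> with its powers \<open>p ^ 2 ^ k\<close>, whose degrees grow only linearly in the exponent, so
  taking roots removes the factor (\<open>norm_lpoly_le\<close>).

  \<^emph>\<open>Square-zero elements are limits of commutators.\<close> If \<open>x x = 0\<close>, put \<open>h = x\<^sup>* x\<close>. Then \<open>h x = 0\<close>, hence
  \<open>f(h) x = 0\<close> and \<open>x f(h) = [x, f(h)]\<close>. If \<open>f\<close> is 1 outside a small neighbourhood of 0, then \<open>x f(h)\<close> is close to
  \<open>x\<close>.

  \<^emph>\<open>Commutators are limits of sums of square-zero elements.\<close> If \<open>f g = 0\<close>, then \<open>f(h) y g(h)\<close> has square
  zero for every \<open>y\<close>. Writing an element as \<open>h + \<i> k\<close> with self-adjoint parts, it suffices to treat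
  \<open>[y, h]\<close>. Cut \<open>h\<close> by a partition of unity into tent functions \<open>a\<^sub>j\<close> of width about \<open>1/n\<close>, so
  that \<open>h\<close> is nearly \<open>\<Sum> c\<^sub>j a\<^sub>j / n\<close>. Then \<open>[y, h]\<close> is nearly \<open>\<Sum> (c\<^sub>i - c\<^sub>j) a\<^sub>j y a\<^sub>i / n\<close>, where the terms
  with \<open>\<bar>i - j\<bar> \<ge> 2\<close> have square zero. The other terms are each of size \<open>1/n\<close>, but there are about \<open>n\<close> of
  them. Their sum is nevertheless of size \<open>1/n\<close>, because \<open>\<Sum> a\<^sub>j y b\<^sub>j\<close> is an average over signs of
  products \<open>(\<Sum> \<plusminus>a\<^sub>j) y (\<Sum> \<plusminus>b\<^sub>j)\<close> (\<open>norm_sum_products_le_signed\<close>).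
\<close>

section \<open>Polynomials in a linear operator\<close>

definition poly_op :: "('c::comm_ring_1 \<Rightarrow> 'b::ab_group_add \<Rightarrow> 'b) \<Rightarrow> ('b \<Rightarrow> 'b) \<Rightarrow> 'c poly \<Rightarrow> 'b \<Rightarrow> 'b"
  where "poly_op s T p y = (\<Sum>k\<le>Polynomial.degree p. s (poly.coeff p k) ((T ^^ k) y))"

locale module_endomorphism = module_hom s s T
  for s :: "'c::comm_ring_1 \<Rightarrow> 'b::ab_group_add \<Rightarrow> 'b" and T :: "'b \<Rightarrow> 'b"
begin

lemma poly_op_eq_sum:
  assumes "Polynomial.degree p \<le> n"
  shows "poly_op s T p y = (\<Sum>k\<le>n. s (poly.coeff p k) ((T ^^ k) y))"
  unfolding poly_op_def
  by (rule sum.mono_neutral_left) (use assms in \<open>auto simp: coeff_eq_0\<close>)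

lemma poly_op_0 [simp]: "poly_op s T 0 y = 0"
  by (simp add: poly_op_def)

lemma poly_op_add: "poly_op s T (p + q) y = poly_op s T p y + poly_op s T q y"
proof -
  let ?n = "max (Polynomial.degree p) (Polynomial.degree q)"
  show ?thesis
    using poly_op_eq_sum[of "p + q" ?n] poly_op_eq_sum[of p ?n] poly_op_eq_sum[of q ?n]
    by (simp add: degree_add_le_max m1.scale_left_distrib sum.distrib)
qed

lemma poly_op_smult: "poly_op s T (Polynomial.smult c p) y = s c (poly_op s T p y)"
  using poly_op_eq_sum[of "Polynomial.smult c p" "Polynomial.degree p"]
  by (simp add: degree_smult_le m1.scale_sum_right poly_op_def)

lemma poly_op_pCons: "poly_op s T (pCons c p) y = s c y + T (poly_op s T p y)"
  using poly_op_eq_sum[OF degree_pCons_le, of c p y]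
  by (simp add: sum.atMost_Suc_shift poly_op_def sum scale del: sum.atMost_Suc)

lemma poly_op_mult: "poly_op s T (p * q) y = poly_op s T p (poly_op s T q y)"
  by (induction p) (simp_all add: poly_op_pCons poly_op_add poly_op_smult)

lemma poly_op_monom: "poly_op s T (monom c n) y = s c ((T ^^ n) y)"
proof (induction n)
  case 0
  then show ?case by (simp add: monom_0 poly_op_pCons)
next
  case (Suc n)
  then show ?case by (simp add: monom_Suc poly_op_pCons scale)
qed

lemma poly_op_scale: "poly_op s T p (s c y) = s c (poly_op s T p y)"
  by (induction p) (simp_all add: poly_op_pCons m1.scale_right_distrib scale mult.commute)

lemma poly_op_zero_right: "poly_op s T p 0 = 0"
  using poly_op_scale[of p 0 0] by simp

lemma funpow_add: "(T ^^ n) (x + y) = (T ^^ n) x + (T ^^ n) y"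
  by (induction n) (simp_all add: add)

lemma funpow_scale: "(T ^^ n) (s c y) = s c ((T ^^ n) y)"
  by (induction n) (simp_all add: scale)

lemma poly_op_funpow: "poly_op s T p ((T ^^ n) y) = (T ^^ n) (poly_op s T p y)"
  using poly_op_mult[of p "monom 1 n" y] poly_op_mult[of "monom 1 n" p y]
  by (simp add: poly_op_monom mult.commute)

end

section \<open>Coefficient and growth estimates\<close>

lemma norm_coeff_le_of_unit_circle:
  assumes "\<And>z. cmod z = 1 \<Longrightarrow> cmod (poly Q z) \<le> B"
  shows "cmod (poly.coeff Q k) \<le> B"
proof -
  have deriv_poly: "deriv (poly R) = poly (pderiv R)" for R :: "complex poly"
    by (simp add: fun_eq_iff DERIV_imp_deriv)
  have "(deriv ^^ k) (poly Q) = poly ((pderiv ^^ k) Q)"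
    by (induction k) (simp_all add: deriv_poly)
  moreover have "poly ((pderiv ^^ k) Q) 0 = fact k * poly.coeff Q k"
    by (simp add: poly_0_coeff_0 coeff_higher_pderiv pochhammer_fact)
  moreover have "norm ((deriv ^^ k) (poly Q) 0) \<le> fact k * B / 1 ^ k"
    by (rule Cauchy_inequality) (use assms in \<open>auto intro!: holomorphic_intros continuous_intros\<close>)
  ultimately show ?thesis
    by (simp add: norm_mult)
qed

lemma le_1_if_powers_linear:
  fixes r c :: real
  assumes "\<And>k. r ^ (2 ^ k) \<le> c * 2 ^ k + 1"
  shows "r \<le> 1"
proof (rule ccontr)
  assume "\<not> r \<le> 1"
  then have r: "r > 1" by simp
  have "(\<lambda>n::nat. (c * real n + 1) / r ^ n) \<longlonglongrightarrow> 0"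
    using r by real_asymp
  then have "\<forall>\<^sub>F n in sequentially. (c * real n + 1) / r ^ n < 1"
    by (rule order_tendstoD) simp
  then obtain N where N: "\<And>n. n \<ge> N \<Longrightarrow> (c * real n + 1) / r ^ n < 1"
    by (auto simp: eventually_sequentially)
  have "N \<le> 2 ^ N" by (simp add: less_imp_le)
  from N[OF this] r have "c * 2 ^ N + 1 < r ^ (2 ^ N)"
    by (simp add: divide_simps)
  with assms[of N] show False by simp
qed

section \<open>The involution\<close>

lemma star_0 [simp]: "star (0 :: 'a::cstar_algebra) = 0"
  using star_add[of "0 :: 'a" 0] by simp

lemma star_minus [simp]: "star (- x) = - star (x :: 'a::cstar_algebra)"
  using star_add[of x "- x"] by (simp add: eq_neg_iff_add_eq_0 add.commute)

lemma star_diff [simp]: "star (x - y) = star x - star (y :: 'a::cstar_algebra)"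
  using star_add[of x "- y"] by simp

lemma star_scaleR [simp]: "star (r *\<^sub>R x) = r *\<^sub>R star (x :: 'a::cstar_algebra)"
  by (simp add: scaleR_scaleC star_scaleC)

lemma norm_star [simp]: "norm (star x) = norm (x :: 'a::cstar_algebra)"
proof -
  have le: "norm y \<le> norm (star y)" for y :: 'a
  proof (cases "y = 0")
    case False
    have "norm y * norm y \<le> norm (star y) * norm y"
      using norm_mult_ineq[of "star y" y] by (simp add: cstar_identity power2_eq_square)
    with False show ?thesis by simp
  qed simp
  show ?thesis using le[of x] le[of "star x"] by (simp add: star_star)
qed

lemma continuous_on_star: "continuous_on S (star :: 'a::cstar_algebra \<Rightarrow> 'a)"
proof (rule continuous_onI)
  fix x :: 'a and e :: real assume "0 < e"
  then show "\<exists>d>0. \<forall>x'\<in>S. dist x' x < d \<longrightarrow> dist (star x') (star x) \<le> e"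
    by (intro exI[of _ e]) (auto simp: dist_norm simp flip: star_diff)
qed

section \<open>A small self-adjoint element as the real part of an isometry\<close>

text \<open>
  The element \<open>z = 1 - sqrt (1 - h\<^sup>2)\<close> lies in the algebra even if the unit does not. It is the fixed
  point of \<open>z \<mapsto> (h\<^sup>2 + z\<^sup>2) / 2\<close>, which is a contraction of the ball of radius 1/2. The map preserves
  the closed set of self-adjoint elements commuting with \<open>h\<close>, so the fixed point lies there.
\<close>

lemma ex_one_minus_sqrt_one_minus_square:
  fixes h :: "'a::cstar_algebra"
  assumes h: "star h = h" "norm h \<le> 1/2"
  obtains z where "h * h + z * z = 2 *\<^sub>R z" "h * z = z * h" "star z = z"
proof -
  define S where "S = {z :: 'a. norm z \<le> 1/2 \<and> h * z = z * h \<and> star z = z}"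
  define f where "f z = (1/2) *\<^sub>R (h * h + z * z)" for z
  have "closed S"
    unfolding S_def
    by (intro closed_Collect_conj closed_Collect_le closed_Collect_eq continuous_intros
        continuous_on_star)
  then have "complete S"
    by (simp add: complete_eq_closed)
  have "\<exists>!z\<in>S. f z = z"
  proof (rule Banach_fix[OF \<open>complete S\<close>])
    show "S \<noteq> {}" by (auto simp: S_def intro!: exI[of _ 0])
    show "f ` S \<subseteq> S"
    proof safe
      fix z assume z: "z \<in> S"
      have "norm h * norm h \<le> 1/2 * (1/2)" "norm z * norm z \<le> 1/2 * (1/2)"
        using z h by (intro mult_mono; simp add: S_def)+
      then have "norm (h * h) \<le> 1/2 * (1/2)" "norm (z * z) \<le> 1/2 * (1/2)"
        using norm_mult_ineq order_trans by blast+
      then have "norm (h * h + z * z) \<le> 1"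
        by (intro norm_triangle_le) simp
      moreover have "h * (z * z) = z * z * h"
        using z by (metis (mono_tags, lifting) S_def mem_Collect_eq mult.assoc)
      ultimately show "f z \<in> S"
        using z h by (simp add: S_def f_def star_add star_mult distrib_left distrib_right mult.assoc)
    qed
    show "dist (f x) (f y) \<le> 1/2 * dist x y" if "x \<in> S" "y \<in> S" for x y
    proof -
      have "f x - f y = (1/2) *\<^sub>R (x * (x - y) + (x - y) * y)"
        by (simp add: f_def algebra_simps)
      also have "norm \<dots> \<le> 1/2 * (norm x * norm (x - y) + norm (x - y) * norm y)"
        by (simp add: norm_triangle_le norm_mult_ineq add_mono)
      also have "\<dots> \<le> 1/2 * (1/2 * norm (x - y) + norm (x - y) * (1/2))"
        using that by (intro mult_left_mono add_mono mult_right_mono) (auto simp: S_def)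
      finally show ?thesis by (simp add: dist_norm)
    qed
  qed simp_all
  then obtain z where z: "z \<in> S" "f z = z" by blast
  have "2 *\<^sub>R z = h * h + z * z"
    by (subst z(2)[symmetric]) (simp add: f_def)
  then show ?thesis by (intro that[of z]) (use z(1) in \<open>simp_all only: S_def mem_Collect_eq\<close>)
qed

text \<open>
  The operator is left multiplication by \<open>h + \<i> sqrt (1 - h\<^sup>2)\<close>. Its inverse \<open>h - \<i> sqrt (1 - h\<^sup>2)\<close> is
  also its adjoint, so it is isometric by the C*-identity. That the sum of the two is \<open>2 h\<close> is
  expressed by the quadratic equation for \<open>U\<close>.
\<close>

lemma ex_isometry_with_real_part:
  fixes h :: "'a::cstar_algebra"
  assumes h: "star h = h" "norm h \<le> 1/2"
  obtains U where "module_endomorphism (*\<^sub>C) U" "\<And>y. norm (U y) = norm y"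
    "\<And>y. U (U y) + y = 2 *\<^sub>R U (h * y)"
proof -
  obtain z where z: "h * h + z * z = 2 *\<^sub>R z" "h * z = z * h" "star z = z"
    using ex_one_minus_sqrt_one_minus_square[OF h] by blast
  have zz: "z * z = 2 *\<^sub>R z - h * h" using z(1) by (simp add: algebra_simps)
  note sc = complex_vector.scale_right_diff_distrib complex_vector.scale_left_diff_distrib
    scaleC_add_right scaleC_add_left scaleC_scaleC mult_scaleC_left mult_scaleC_right
  \<comment> \<open>\<open>c = \<i>\<close> gives the operator \<open>U\<close> and \<open>c = - \<i>\<close> its inverse.\<close>
  define V where "V c y = h * y + c *\<^sub>C (y - z * y)" for c y
  have V: "V (- c) (V c y) = y" if "c * c = -1" for c y
  proof -
    have zz': "z * (z * y) = 2 *\<^sub>R (z * y) - h * (h * y)"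
      using arg_cong[OF zz, of "\<lambda>x. x * y"] by (simp add: mult.assoc algebra_simps)
    have hz': "h * (z * y) = z * (h * y)"
      using arg_cong[OF z(2), of "\<lambda>x. x * y"] by (simp add: mult.assoc)
    show ?thesis
      using that
      by (simp add: V_def sc algebra_simps zz' hz' scaleR_2)
  qed
  have hom: "module_endomorphism (*\<^sub>C) (V c)" for c
    by unfold_locales (simp_all add: V_def algebra_simps sc scaleC_one)
  have adj: "star (V \<i> x) * y = star x * V (- \<i>) y" for x y
    using h z by (simp add: V_def star_add star_mult star_scaleC algebra_simps sc)
  show ?thesis
  proof
    show "module_endomorphism (*\<^sub>C) (V \<i>)" by (rule hom)
    show "norm (V \<i> y) = norm y" for y
      using cstar_identity[of "V \<i> y"] adj[of y "V \<i> y"] V[of \<i> y] cstar_identity[of y] by simp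
    fix y
    have "V \<i> y + V (- \<i>) y = 2 *\<^sub>R (h * y)"
      by (simp add: V_def scaleR_2)
    then have "V \<i> (V \<i> y + V (- \<i>) y) = V \<i> (2 *\<^sub>R (h * y))" by simp
    also have "V \<i> (V \<i> y + V (- \<i>) y) = V \<i> (V \<i> y) + y"
      using V[of "- \<i>" y] by (simp add: module_hom.add[OF hom[unfolded module_endomorphism_def]])
    finally show "V \<i> (V \<i> y) + y = 2 *\<^sub>R V \<i> (h * y)"
      by (simp add: scaleR_scaleC module_hom.scale[OF hom[unfolded module_endomorphism_def]])
  qed
qed

section \<open>Polynomials in a small self-adjoint element\<close>

abbreviation lpoly :: "'a::real_algebra \<Rightarrow> real poly \<Rightarrow> 'a \<Rightarrow> 'a"
  where "lpoly h \<equiv> poly_op (*\<^sub>R) ((*) h)"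

lemma module_endomorphism_mult_left: "module_endomorphism (*\<^sub>R) ((*) (h :: 'a::real_algebra))"
  by unfold_locales (simp_all add: algebra_simps)

interpretation L: module_endomorphism "(*\<^sub>R)" "(*) (h :: 'a::real_algebra)" for h
  by (rule module_endomorphism_mult_left)

lemma lpoly_mult_right: "lpoly h p x * y = lpoly h p (x * y)"
  by (induction p) (simp_all add: L.poly_op_pCons algebra_simps)

lemma lpoly_commute: "h * lpoly h p y = lpoly h p (h * y)"
  using L.poly_op_funpow[of h p 1 y] by simp

lemma star_lpoly:
  assumes "star h = h"
  shows "star (lpoly h p x) * y = star x * lpoly h p (y :: 'a::cstar_algebra)"
proof (induction p arbitrary: y)
  case (pCons c p)
  have "star (h * lpoly h p x) * y = star (lpoly h p x) * (h * y)"
    using assms by (simp add: star_mult mult.assoc)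
  also have "\<dots> = star x * (h * lpoly h p y)"
    by (simp add: pCons.IH lpoly_commute)
  finally show ?case
    by (simp add: L.poly_op_pCons star_add distrib_left distrib_right pCons.IH)
qed simp

text \<open>
  On the unit circle \<open>Re z = (z + inverse z) / 2\<close>, so \<open>z ^ d * p (Re z)\<close> agrees there with a
  polynomial \<open>Q\<close> of degree at most \<open>2 d\<close>. The isometry \<open>U\<close> with real part \<open>h\<close> satisfies the same
  relation, which gives \<open>U\<^sup>d p(h) = Q(U)\<close>. The norm of the right-hand side is at most the sum of the
  absolute values of the coefficients of \<open>Q\<close>.
\<close>

lemma norm_lpoly_le_degree:
  fixes h :: "'a::cstar_algebra"
  assumes h: "star h = h" "norm h \<le> 1/2"
    and S: "\<And>t. t \<in> {-1..1} \<Longrightarrow> \<bar>poly p t\<bar> \<le> S"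
  shows "norm (lpoly h p y) \<le> (2 * real (Polynomial.degree p) + 1) * S * norm y"
proof -
  obtain U where U: "module_endomorphism (*\<^sub>C) U" "\<And>y. norm (U y) = norm (y :: 'a)"
    and UU: "\<And>y. U (U y) + y = 2 *\<^sub>R U (h * y)"
    using ex_isometry_with_real_part[OF h] by metis
  interpret U: module_endomorphism "(*\<^sub>C)" U by fact
  have isom: "norm ((U ^^ k) y) = norm y" for k y
    by (induction k) (simp_all add: U(2))
  have "\<exists>Q. Polynomial.degree Q \<le> 2 * Polynomial.degree p
      \<and> (\<forall>z. cmod z = 1 \<longrightarrow> poly Q z = z ^ Polynomial.degree p * of_real (poly p (Re z)))
      \<and> (\<forall>y. (U ^^ Polynomial.degree p) (lpoly h p y) = poly_op (*\<^sub>C) U Q y)"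
  proof (induction p)
    case 0
    then show ?case by (intro exI[of _ 0]) simp
  next
    case (pCons c p)
    show ?case
    proof (cases "p = 0")
      case True
      then show ?thesis
        by (intro exI[of _ "[:of_real c:]"]) (simp add: L.poly_op_pCons U.poly_op_pCons,
            simp add: scaleR_scaleC)
    next
      case False
      define d where "d = Polynomial.degree p"
      obtain Q where Q: "Polynomial.degree Q \<le> 2 * d"
        "\<And>z. cmod z = 1 \<Longrightarrow> poly Q z = z ^ d * of_real (poly p (Re z))"
        "\<And>y. (U ^^ d) (lpoly h p y) = poly_op (*\<^sub>C) U Q y"
        using pCons.IH d_def by metis
      \<comment> \<open>Multiplying by \<open>(1 + z\<^sup>2) / 2 = z Re z\<close> multiplies \<open>p\<close> by its variable and raises \<open>d\<close> by 1.\<close>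
      define Q' where "Q' = monom (of_real c) (Suc d) + [:1/2, 0, 1/2:] * Q"
      have "Polynomial.degree Q' \<le> 2 * Suc d"
        unfolding Q'_def
        by (intro degree_add_le order_trans[OF degree_monom_le] order_trans[OF degree_mult_le])
          (use Q(1) in \<open>simp_all\<close>)
      moreover have "poly Q' z = z ^ Suc d * of_real (poly (pCons c p) (Re z))" if "cmod z = 1" for z
      proof -
        have "z * cnj z = 1" using that by (simp flip: complex_norm_square)
        moreover have "of_real (Re z) = (z + cnj z) / 2" by (simp add: complex_add_cnj)
        ultimately have "(1 + z * z) / 2 = z * of_real (Re z)" by (simp add: algebra_simps)
        moreover have "poly Q' z
            = of_real c * z ^ Suc d + (1 + z * z) / 2 * (z ^ d * of_real (poly p (Re z)))"
          using that by (simp add: Q'_def Q(2) poly_monom algebra_simps add_divide_distrib)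
        ultimately show ?thesis
          by (simp only:) (simp add: algebra_simps)
      qed
      moreover have "(U ^^ Suc d) (lpoly h (pCons c p) y) = poly_op (*\<^sub>C) U Q' y" for y
      proof -
        have half: "U (h * w) = poly_op (*\<^sub>C) U [:1/2, 0, 1/2:] w" for w
        proof -
          have "U (h * w) = (1/2) *\<^sub>R (U (U w) + w)" by (simp add: UU)
          also have "\<dots> = poly_op (*\<^sub>C) U [:1/2, 0, 1/2:] w"
            by (simp add: U.poly_op_pCons U.scale scaleR_scaleC scaleC_add_right)
          finally show ?thesis .
        qed
        have "(U ^^ Suc d) (lpoly h (pCons c p) y)
            = of_real c *\<^sub>C (U ^^ Suc d) y + (U ^^ d) (U (h * lpoly h p y))"
          by (simp add: L.poly_op_pCons scaleR_scaleC funpow_Suc_right U.funpow_add U.funpow_scale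
              U.add U.scale del: funpow.simps)
        also have "\<dots> = poly_op (*\<^sub>C) U Q' y"
          unfolding Q'_def half U.poly_op_funpow[symmetric] Q(3) U.poly_op_add U.poly_op_mult
            U.poly_op_monom ..
        finally show ?thesis .
      qed
      ultimately show ?thesis
        using False by (intro exI[of _ Q']) (simp add: d_def)
    qed
  qed
  then obtain Q where Q: "Polynomial.degree Q \<le> 2 * Polynomial.degree p"
    "\<And>z. cmod z = 1 \<Longrightarrow> poly Q z = z ^ Polynomial.degree p * of_real (poly p (Re z))"
    "\<And>y. (U ^^ Polynomial.degree p) (lpoly h p y) = poly_op (*\<^sub>C) U Q y"
    by blast
  have coeff: "cmod (poly.coeff Q k) \<le> S" for k
  proof (rule norm_coeff_le_of_unit_circle)
    fix z assume "cmod z = 1"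
    then show "cmod (poly Q z) \<le> S"
      using S[of "Re z"] abs_Re_le_cmod[of z] by (simp add: Q(2) norm_mult norm_power abs_le_iff)
  qed
  then have "0 \<le> S" using norm_ge_zero order_trans by blast
  have "norm (lpoly h p y) = norm (poly_op (*\<^sub>C) U Q y)"
    by (metis isom Q(3))
  also have "\<dots> \<le> (\<Sum>k\<le>2 * Polynomial.degree p. norm (poly.coeff Q k *\<^sub>C (U ^^ k) y))"
    unfolding U.poly_op_eq_sum[OF Q(1)] by (rule norm_sum)
  also have "\<dots> \<le> (\<Sum>k\<le>2 * Polynomial.degree p. S * norm y)"
    by (intro sum_mono) (simp add: norm_scaleC isom coeff mult_right_mono)
  finally show ?thesis by (simp add: algebra_simps)
qed

text \<open>
  For self-adjoint \<open>h\<close> and unit \<open>y\<close> the C*-identity gives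
  \<open>\<parallel>p(h) y\<parallel>\<^sup>2 = \<parallel>y\<^sup>* p\<^sup>2(h) y\<parallel> \<le> \<parallel>p\<^sup>2(h) y\<parallel>\<close>, and this can be iterated.
\<close>

lemma norm_lpoly_power_le:
  fixes h :: "'a::cstar_algebra"
  assumes "star h = h" "norm y = 1"
  shows "norm (lpoly h p y) ^ (2 ^ k) \<le> norm (lpoly h (p ^ (2 ^ k)) y)"
proof (induction k arbitrary: p)
  case (Suc k)
  have "(norm (lpoly h p y))\<^sup>2 = norm (star y * lpoly h (p * p) y)"
    using assms by (simp add: star_lpoly L.poly_op_mult flip: cstar_identity)
  also have "\<dots> \<le> norm (lpoly h (p * p) y)"
    using norm_mult_ineq[of "star y"] assms by simp
  finally have "((norm (lpoly h p y))\<^sup>2) ^ (2 ^ k) \<le> norm (lpoly h (p * p) y) ^ (2 ^ k)"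
    by (intro power_mono) simp_all
  also have "\<dots> \<le> norm (lpoly h ((p * p) ^ (2 ^ k)) y)" by (rule Suc.IH)
  finally show ?case
    by (simp add: power_mult mult.commute power2_eq_square)
qed simp

text \<open>
  The factor linear in the degree disappears when the preceding estimate is applied to \<open>p ^ 2 ^ k\<close>
  and the root of order \<open>2 ^ k\<close> is taken.
\<close>

lemma norm_lpoly_le:
  fixes h :: "'a::cstar_algebra"
  assumes h: "star h = h" "norm h \<le> 1/2"
    and S: "\<And>t. t \<in> {-1..1} \<Longrightarrow> \<bar>poly p t\<bar> \<le> S"
  shows "norm (lpoly h p y) \<le> S * norm y"
proof -
  have unit: "norm (lpoly h p y) \<le> S" if y: "norm y = 1" for y
  proof (rule dense_ge)
    \<comment> \<open>A strict upper bound is positive, which permits division by it.\<close>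
    fix S' assume "S < S'"
    have "S' > 0" using S[of 0] \<open>S < S'\<close> by simp
    define c where "c = 2 * real (Polynomial.degree p)"
    have "(norm (lpoly h p y) / S') ^ (2 ^ k) \<le> c * 2 ^ k + 1" for k
    proof -
      have "norm (lpoly h p y) ^ (2 ^ k) \<le> norm (lpoly h (p ^ (2 ^ k)) y)"
        by (rule norm_lpoly_power_le) fact+
      also have "\<dots> \<le> (2 * real (Polynomial.degree (p ^ (2 ^ k))) + 1) * S' ^ (2 ^ k) * norm y"
        by (rule norm_lpoly_le_degree[OF h])
          (use S \<open>S < S'\<close> in \<open>force simp: poly_power power_abs intro!: power_mono\<close>)
      also have "\<dots> \<le> (c * 2 ^ k + 1) * S' ^ (2 ^ k)"
      proof -
        have "real (Polynomial.degree (p ^ (2 ^ k))) \<le> real (Polynomial.degree p * 2 ^ k)"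
          using degree_power_le[of p "2 ^ k"] by (simp only: of_nat_le_iff)
        then have "2 * real (Polynomial.degree (p ^ (2 ^ k))) + 1 \<le> c * 2 ^ k + 1"
          by (simp add: c_def)
        from mult_right_mono[OF this, of "S' ^ (2 ^ k)"] show ?thesis
          using \<open>S' > 0\<close> y by simp
      qed
      finally show ?thesis
        using \<open>S' > 0\<close> by (simp add: power_divide divide_le_eq)
    qed
    then have "norm (lpoly h p y) / S' \<le> 1"
      by (rule le_1_if_powers_linear)
    then show "norm (lpoly h p y) \<le> S'"
      using \<open>S' > 0\<close> by simp
  qed
  show ?thesis
  proof (cases "y = 0")
    case True
    then show ?thesis by (simp add: L.poly_op_zero_right)
  next
    case False
    have "norm (lpoly h p ((1 / norm y) *\<^sub>R y)) \<le> S"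
      by (rule unit) (use False in simp)
    then show ?thesis
      using False by (simp add: L.poly_op_scale divide_le_eq)
  qed
qed

section \<open>Continuous functional calculus for a small self-adjoint element\<close>

definition calc_functions :: "(real \<Rightarrow> real) set"
  where "calc_functions = {f. continuous_on {-1..1} f \<and> f 0 = 0}"

lemma calc_functions_scaleR: "f \<in> calc_functions \<Longrightarrow> (\<lambda>t. c * f t) \<in> calc_functions"
  by (auto simp: calc_functions_def intro!: continuous_intros)

lemma calc_functions_diff:
  "f \<in> calc_functions \<Longrightarrow> g \<in> calc_functions \<Longrightarrow> (\<lambda>t. f t - g t) \<in> calc_functions"
  by (auto simp: calc_functions_def intro!: continuous_intros)

lemma calc_functions_mult:
  "f \<in> calc_functions \<Longrightarrow> g \<in> calc_functions \<Longrightarrow> (\<lambda>t. f t * g t) \<in> calc_functions"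
  by (auto simp: calc_functions_def intro!: continuous_intros)

lemma calc_functions_sum:
  "(\<And>j. j \<in> J \<Longrightarrow> f j \<in> calc_functions) \<Longrightarrow> (\<lambda>t. \<Sum>j\<in>J. f j t) \<in> calc_functions"
  by (auto simp: calc_functions_def intro!: continuous_intros)

lemma calc_functions_ident: "(\<lambda>t. t) \<in> calc_functions"
  by (simp add: calc_functions_def)

lemma calc_functions_bounded: "f \<in> calc_functions \<Longrightarrow> bounded (f ` {-1..1})"
  by (auto simp: calc_functions_def intro!: compact_imp_bounded compact_continuous_image)

lemma calc_functions_approx:
  assumes "f \<in> calc_functions" "e > 0"
  obtains p where "\<And>t. t \<in> {-1..1} \<Longrightarrow> \<bar>t * poly p t - f t\<bar> < e"
proof -
  obtain g where g: "real_polynomial_function g" "\<And>t. t \<in> {-1..1} \<Longrightarrow> \<bar>f t - g t\<bar> < e/2"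
    using Stone_Weierstrass_real_polynomial_function[of "{-1..1}" f "e/2"] assms
    by (auto simp: calc_functions_def)
  obtain a n where a: "g = (\<lambda>x. \<Sum>i\<le>n. a i * x ^ i)"
    using g(1) real_polynomial_function_iff_sum by blast
  define p where "p = (\<Sum>i<n. monom (a (Suc i)) i)"
  have eq: "t * poly p t = g t - g 0" for t
    by (simp add: a p_def poly_sum poly_monom sum_distrib_left sum.atMost_shift mult_ac)
  have "f 0 = 0" using assms by (simp add: calc_functions_def)
  have "\<bar>t * poly p t - f t\<bar> < e" if "t \<in> {-1..1}" for t
  proof -
    have "\<bar>f t - g t\<bar> < e / 2" "\<bar>f 0 - g 0\<bar> < e / 2"
      using g(2) that by simp_all
    then show ?thesis
      unfolding eq using \<open>f 0 = 0\<close> by linarith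
  qed
  then show ?thesis using that by blast
qed

locale small_selfadjoint =
  fixes h :: "'a::cstar_algebra"
  assumes selfadjoint: "star h = h" and small: "norm h \<le> 1/2"
begin

text \<open>
  The element \<open>lpoly h p h\<close> is the value at \<open>h\<close> of the polynomial \<open>t p(t)\<close>. Polynomials of this form are
  those that can be evaluated without a unit, and their norm bound is passed from the action on the
  algebra to the element by testing it on the adjoint of the element.
\<close>

lemma norm_lpoly_self_le:
  assumes "\<And>t. t \<in> {-1..1} \<Longrightarrow> \<bar>t * poly p t\<bar> \<le> S"
  shows "norm (lpoly h p h) \<le> S"
proof -
  define a where "a = lpoly h p h"
  have "a * star a = lpoly h (pCons 0 p) (star a)"
    by (simp add: a_def lpoly_mult_right L.poly_op_pCons lpoly_commute)
  moreover have "norm (lpoly h (pCons 0 p) (star a)) \<le> S * norm (star a)"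
    by (rule norm_lpoly_le[OF selfadjoint small]) (use assms in simp)
  ultimately have "norm a * norm a \<le> S * norm a"
    using cstar_identity[of "star a"] by (simp add: star_star power2_eq_square)
  moreover have "S \<ge> 0" using assms[of 0] by simp
  ultimately have "norm a \<le> S"
    by (cases "norm a = 0") (auto simp only: mult_le_cancel_right norm_le_zero_iff)
  then show ?thesis by (simp only: a_def)
qed

text \<open>
  The graph of the functional calculus: limits of polynomials without constant term. A relation
  lets the algebraic laws be read off from those of polynomials before it is known to be a function.
\<close>

definition represents :: "(real \<Rightarrow> real) \<Rightarrow> 'a \<Rightarrow> bool"
  where "represents f a \<longleftrightarrow> (\<exists>P. uniform_limit {-1..1} (\<lambda>n t. t * poly (P n) t) f sequentially
    \<and> (\<lambda>n. lpoly h (P n) h) \<longlonglongrightarrow> a)"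

lemma represents_norm_le:
  assumes "represents f a" "\<And>t. t \<in> {-1..1} \<Longrightarrow> \<bar>f t\<bar> \<le> S"
  shows "norm a \<le> S"
proof (rule field_le_epsilon)
  fix e :: real assume "0 < e"
  obtain P where P: "uniform_limit {-1..1} (\<lambda>n t. t * poly (P n) t) f sequentially"
    "(\<lambda>n. lpoly h (P n) h) \<longlonglongrightarrow> a"
    using assms(1) by (auto simp: represents_def)
  have "\<forall>\<^sub>F n in sequentially. norm (lpoly h (P n) h) \<le> S + e"
    using uniform_limitD[OF P(1) \<open>0 < e\<close>]
  proof eventually_elim
    case (elim n)
    show ?case
    proof (rule norm_lpoly_self_le)
      fix t :: real assume "t \<in> {-1..1}"
      with elim assms(2) have "\<bar>t * poly (P n) t - f t\<bar> < e" "\<bar>f t\<bar> \<le> S"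
        by (auto simp: dist_real_def)
      then show "\<bar>t * poly (P n) t\<bar> \<le> S + e" by linarith
    qed
  qed
  then show "norm a \<le> S + e"
    using tendsto_upperbound[OF tendsto_norm[OF P(2)]] by simp
qed

lemma represents_add:
  assumes "represents f a" "represents g b"
  shows "represents (\<lambda>t. f t + g t) (a + b)"
proof -
  obtain P Q where "uniform_limit {-1..1} (\<lambda>n t. t * poly (P n) t) f sequentially"
    "(\<lambda>n. lpoly h (P n) h) \<longlonglongrightarrow> a"
    "uniform_limit {-1..1} (\<lambda>n t. t * poly (Q n) t) g sequentially"
    "(\<lambda>n. lpoly h (Q n) h) \<longlonglongrightarrow> b"
    using assms by (auto simp: represents_def)
  then show ?thesis
    unfolding represents_def
    by (intro exI[of _ "\<lambda>n. P n + Q n"])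
      (auto simp: L.poly_op_add algebra_simps intro!: tendsto_intros uniform_limit_intros)
qed

lemma represents_scaleR:
  assumes "represents f a"
  shows "represents (\<lambda>t. c * f t) (c *\<^sub>R a)"
proof -
  obtain P where "uniform_limit {-1..1} (\<lambda>n t. t * poly (P n) t) f sequentially"
    "(\<lambda>n. lpoly h (P n) h) \<longlonglongrightarrow> a"
    using assms by (auto simp: represents_def)
  then show ?thesis
    unfolding represents_def
    by (intro exI[of _ "\<lambda>n. Polynomial.smult c (P n)"])
      (auto simp: L.poly_op_smult mult.left_commute[of _ c] intro!: tendsto_intros uniform_limit_intros)
qed

lemma represents_mult:
  assumes "represents f a" "represents g b" "f \<in> calc_functions" "g \<in> calc_functions"
  shows "represents (\<lambda>t. f t * g t) (a * b)"
proof -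
  obtain P Q where PQ: "uniform_limit {-1..1} (\<lambda>n t. t * poly (P n) t) f sequentially"
    "(\<lambda>n. lpoly h (P n) h) \<longlonglongrightarrow> a"
    "uniform_limit {-1..1} (\<lambda>n t. t * poly (Q n) t) g sequentially"
    "(\<lambda>n. lpoly h (Q n) h) \<longlonglongrightarrow> b"
    using assms by (auto simp: represents_def)
  have "lpoly h (P n) h * lpoly h (Q n) h = lpoly h (P n * pCons 0 (Q n)) h" for n
    by (simp add: L.poly_op_mult L.poly_op_pCons lpoly_mult_right lpoly_commute)
  then have "(\<lambda>n. lpoly h (P n * pCons 0 (Q n)) h) \<longlonglongrightarrow> a * b"
    using tendsto_mult[OF PQ(2,4)] by simp
  moreover have "uniform_limit {-1..1} (\<lambda>n t. t * poly (P n * pCons 0 (Q n)) t)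
      (\<lambda>t. f t * g t) sequentially"
    using uniform_lim_mult[OF PQ(1,3)] assms(3,4)[THEN calc_functions_bounded]
    by (simp add: mult_ac)
  ultimately show ?thesis
    unfolding represents_def by (intro exI[of _ "\<lambda>n. P n * pCons 0 (Q n)"] conjI)
qed

lemma represents_ident: "represents (\<lambda>t. t) h"
  unfolding represents_def by (intro exI[of _ "\<lambda>n. 1"]) (simp add: poly_op_def uniform_limit_const)

lemma represents_unique:
  assumes "represents f a" "represents g b" "\<And>t. t \<in> {-1..1} \<Longrightarrow> f t = g t"
  shows "a = b"
proof -
  have "represents (\<lambda>t. f t + (-1) * g t) (a + (-1) *\<^sub>R b)"
    by (intro represents_add represents_scaleR assms)
  from represents_norm_le[OF this, of 0] assms(3) show ?thesis by simp
qed

lemma ex_represents: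
  assumes "f \<in> calc_functions"
  shows "\<exists>a. represents f a"
proof -
  have "\<exists>p. \<forall>t\<in>{-1..1}. \<bar>t * poly p t - f t\<bar> < inverse (real (Suc n))" for n
    using calc_functions_approx[OF assms, of "inverse (real (Suc n))"]
    by (metis inverse_positive_iff_positive of_nat_0_less_iff zero_less_Suc)
  then obtain P where P: "\<And>n t. t \<in> {-1..1} \<Longrightarrow> \<bar>t * poly (P n) t - f t\<bar> < inverse (real (Suc n))"
    by metis
  have lim: "uniform_limit {-1..1} (\<lambda>n t. t * poly (P n) t) f sequentially"
  proof (rule uniform_limitI)
    fix e :: real assume "0 < e"
    with LIMSEQ_inverse_real_of_nat have "\<forall>\<^sub>F n in sequentially. inverse (real (Suc n)) < e"
      by (rule order_tendstoD)
    then show "\<forall>\<^sub>F n in sequentially. \<forall>t\<in>{-1..1}. dist (t * poly (P n) t) (f t) < e"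
      by eventually_elim (use P in \<open>auto simp only: dist_real_def intro: less_trans\<close>)
  qed
  then have "uniformly_Cauchy_on {-1..1} (\<lambda>n t. t * poly (P n) t)"
    by (auto intro!: uniformly_convergent_Cauchy simp: uniformly_convergent_on_def)
  have "Cauchy (\<lambda>n. lpoly h (P n) h)"
  proof (rule metric_CauchyI)
    fix e :: real assume "0 < e"
    then obtain M where M: "\<And>t m n. t \<in> {-1..1} \<Longrightarrow> m \<ge> M \<Longrightarrow> n \<ge> M \<Longrightarrow>
        dist (t * poly (P m) t) (t * poly (P n) t) < e / 2"
      using \<open>uniformly_Cauchy_on _ _\<close> unfolding uniformly_Cauchy_on_def by (meson half_gt_zero)
    show "\<exists>M. \<forall>m\<ge>M. \<forall>n\<ge>M. dist (lpoly h (P m) h) (lpoly h (P n) h) < e"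
    proof (intro exI allI impI)
      fix m n assume mn: "m \<ge> M" "n \<ge> M"
      have "norm (lpoly h (P m + Polynomial.smult (-1) (P n)) h) \<le> e / 2"
        by (rule norm_lpoly_self_le)
          (use M[OF _ mn] in \<open>force simp: dist_real_def algebra_simps intro: less_imp_le\<close>)
      also have "\<dots> < e" using \<open>0 < e\<close> by simp
      finally show "dist (lpoly h (P m) h) (lpoly h (P n) h) < e"
        unfolding L.poly_op_add L.poly_op_smult by (simp add: dist_norm)
    qed
  qed
  then obtain a where "(\<lambda>n. lpoly h (P n) h) \<longlonglongrightarrow> a"
    using Cauchy_convergent convergent_def by blast
  with lim show ?thesis unfolding represents_def by blast
qed

definition calc :: "(real \<Rightarrow> real) \<Rightarrow> 'a"
  where "calc f = (THE a. represents f a)"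

lemma calc_eqI: "represents f a \<Longrightarrow> calc f = a"
  unfolding calc_def by (rule the_equality) (auto intro: represents_unique)

lemma represents_calc: "f \<in> calc_functions \<Longrightarrow> represents f (calc f)"
  using ex_represents calc_eqI by metis

lemma norm_calc_le:
  "f \<in> calc_functions \<Longrightarrow> (\<And>t. t \<in> {-1..1} \<Longrightarrow> \<bar>f t\<bar> \<le> S) \<Longrightarrow> norm (calc f) \<le> S"
  using represents_calc represents_norm_le by blast

lemma calc_cong:
  "f \<in> calc_functions \<Longrightarrow> g \<in> calc_functions \<Longrightarrow> (\<And>t. t \<in> {-1..1} \<Longrightarrow> f t = g t) \<Longrightarrow> calc f = calc g"
  using represents_calc represents_unique by blast

lemma calc_ident: "calc (\<lambda>t. t) = h"
  by (rule calc_eqI[OF represents_ident])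

lemma calc_add:
  "f \<in> calc_functions \<Longrightarrow> g \<in> calc_functions \<Longrightarrow> calc (\<lambda>t. f t + g t) = calc f + calc g"
  by (intro calc_eqI represents_add represents_calc)

lemma calc_scaleR: "f \<in> calc_functions \<Longrightarrow> calc (\<lambda>t. c * f t) = c *\<^sub>R calc f"
  by (intro calc_eqI represents_scaleR represents_calc)

lemma calc_diff:
  "f \<in> calc_functions \<Longrightarrow> g \<in> calc_functions \<Longrightarrow> calc (\<lambda>t. f t - g t) = calc f - calc g"
  using calc_add[of f "\<lambda>t. -1 * g t"] calc_scaleR[of g "-1"] calc_functions_scaleR[of g "-1"] by simp

lemma calc_mult:
  "f \<in> calc_functions \<Longrightarrow> g \<in> calc_functions \<Longrightarrow> calc (\<lambda>t. f t * g t) = calc f * calc g"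
  by (intro calc_eqI represents_mult represents_calc)

lemma calc_zero: "calc (\<lambda>t. 0) = 0"
  using calc_scaleR[OF calc_functions_ident, of 0] by simp

lemma calc_sum:
  assumes "\<And>j. j \<in> J \<Longrightarrow> f j \<in> calc_functions"
  shows "calc (\<lambda>t. \<Sum>j\<in>J. w j * f j t) = (\<Sum>j\<in>J. w j *\<^sub>R calc (f j))"
  using assms
proof (induction J rule: infinite_finite_induct)
  case (insert j J)
  then show ?case
    by (simp add: calc_add calc_scaleR calc_functions_scaleR calc_functions_sum)
qed (simp_all add: calc_zero)

lemma star_calc:
  assumes "f \<in> calc_functions"
  shows "star (calc f) = calc f"
proof -
  obtain P where P: "(\<lambda>n. lpoly h (P n) h) \<longlonglongrightarrow> calc f"
    using represents_calc[OF assms] by (auto simp: represents_def)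
  have "star (lpoly h p h) = lpoly h p h" for p
  proof (induction p)
    case (pCons c p)
    have "h * lpoly h p h = lpoly h p h * h"
      by (simp add: lpoly_commute lpoly_mult_right)
    with pCons show ?case
      by (simp add: L.poly_op_pCons star_add star_mult selfadjoint)
  qed simp
  then have "(\<lambda>n. lpoly h (P n) h) \<longlonglongrightarrow> star (calc f)"
    using continuous_on_tendsto_compose[OF continuous_on_star[of UNIV] P] by simp
  then show ?thesis using P LIMSEQ_unique by blast
qed

lemma calc_annihilates:
  assumes "f \<in> calc_functions" "h * x = 0"
  shows "calc f * x = 0"
proof -
  obtain P where P: "(\<lambda>n. lpoly h (P n) h) \<longlonglongrightarrow> calc f"
    using represents_calc[OF assms(1)] by (auto simp: represents_def)
  have "lpoly h p h * x = 0" for p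
    using assms(2) by (simp add: lpoly_mult_right L.poly_op_zero_right)
  then have "(\<lambda>_. 0) \<longlonglongrightarrow> calc f * x"
    using tendsto_mult_right[OF P, of x] by simp
  then show ?thesis by (simp add: LIMSEQ_const_iff)
qed

end

section \<open>Square-zero elements are limits of commutators\<close>

lemma bounded_linear_scaleC: "bounded_linear (\<lambda>x :: 'a::complex_normed_algebra. c *\<^sub>C x)"
  by (rule bounded_linear_intro[of _ "cmod c"])
    (simp_all add: scaleC_add_right scaleR_scaleC scaleC_scaleC norm_scaleC mult.commute)

lemma csubspace_closure:
  assumes "csubspace (S :: 'a::complex_normed_algebra set)"
  shows "csubspace (closure S)"
proof (rule complex_vector.subspaceI)
  show "0 \<in> closure S"
    using assms closure_subset complex_vector.subspace_0 by blast
  show "x + y \<in> closure S" if xy: "x \<in> closure S" "y \<in> closure S" for x y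
  proof -
    obtain f g where "\<forall>n. f n \<in> S" "f \<longlonglongrightarrow> x" "\<forall>n. g n \<in> S" "g \<longlonglongrightarrow> y"
      using xy unfolding closure_sequential by blast
    then show ?thesis
      unfolding closure_sequential
      by (intro exI[of _ "\<lambda>n. f n + g n"])
        (auto intro: tendsto_add complex_vector.subspace_add[OF assms])
  qed
  show "c *\<^sub>C x \<in> closure S" if x: "x \<in> closure S" for c x
  proof -
    obtain f where "\<forall>n. f n \<in> S" "f \<longlonglongrightarrow> x"
      using x unfolding closure_sequential by blast
    then show ?thesis
      unfolding closure_sequential
      by (intro exI[of _ "\<lambda>n. c *\<^sub>C f n"])
        (auto intro: bounded_linear.tendsto[OF bounded_linear_scaleC]
          complex_vector.subspace_scale[OF assms])
  qed
qed

lemma csubspace_scaleR: "csubspace S \<Longrightarrow> x \<in> S \<Longrightarrow> r *\<^sub>R x \<in> S"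
  by (simp add: scaleR_scaleC complex_vector.subspace_scale)

lemma small_multiple:
  fixes x :: "'a::real_normed_vector"
  obtains r where "r > 0" "norm (r *\<^sub>R x) \<le> 1/2"
proof
  show "1 / (2 * (norm x + 1)) > 0"
    by (simp add: add_nonneg_pos)
  show "norm ((1 / (2 * (norm x + 1))) *\<^sub>R x) \<le> 1/2"
    using norm_ge_zero[of x] by (simp add: divide_simps del: norm_ge_zero)
qed

text \<open>
  With \<open>h = x\<^sup>* x\<close> and \<open>p = f(h)\<close> one has \<open>p x = 0\<close>, so \<open>x p\<close> is a commutator. The square of its distance
  to \<open>x\<close> is the norm of \<open>(1 - p) h (1 - p)\<close>, which is at most the supremum of \<open>\<bar>t\<bar> (1 - f t)\<^sup>2\<close>.
  This is small if \<open>f\<close> takes values in \<open>[0,1]\<close> and equals 1 outside a small neighbourhood of 0.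
\<close>

lemma small_square_zero_in_closure_commutator_span:
  fixes x :: "'a::cstar_algebra"
  assumes x: "x * x = 0" "norm x \<le> 1/2"
  shows "x \<in> closure commutator_span"
proof -
  define h where "h = star x * x"
  have "norm x * norm x \<le> 1/2 * 1"
    using x(2) by (intro mult_mono) simp_all
  then interpret small_selfadjoint h
    by unfold_locales (simp_all add: h_def star_mult star_star cstar_identity power2_eq_square)
  have hx: "h * x = 0" by (simp add: h_def mult.assoc x(1))
  show ?thesis
  proof (subst closure_approachable, intro allI impI)
    fix e :: real assume "0 < e"
    \<comment> \<open>The C*-identity bounds the square of the distance, hence the square here.\<close>
    define d where "d = (e / 2)\<^sup>2"
    have "d > 0" using \<open>0 < e\<close> by (simp add: d_def)
    define f where "f t = min 1 (\<bar>t\<bar> / d)" for t :: real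
    have f: "f \<in> calc_functions"
      using \<open>d > 0\<close> by (auto simp: f_def calc_functions_def intro!: continuous_intros)
    define p where "p = calc f"
    have p: "star p = p" "p * x = 0"
      using star_calc[OF f] calc_annihilates[OF f hx] by (simp_all add: p_def)
    define g where "g t = (t - t * f t) - f t * (t - t * f t)" for t
    have tf: "(\<lambda>t. t - t * f t) \<in> calc_functions"
      by (intro calc_functions_diff calc_functions_mult calc_functions_ident f)
    have "star (x - x * p) * (x - x * p) = (h - h * p) - p * (h - h * p)"
      by (simp add: star_mult p(1) h_def algebra_simps)
    also have "\<dots> = calc g"
      unfolding g_def p_def
      by (simp add: calc_diff calc_mult calc_ident calc_functions_mult calc_functions_ident f tf)
    finally have "(norm (x - x * p))\<^sup>2 = norm (calc g)"
      by (simp flip: cstar_identity)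
    also have "\<dots> \<le> d"
    proof (rule norm_calc_le)
      show "g \<in> calc_functions"
        unfolding g_def by (intro calc_functions_diff calc_functions_mult f tf)
      fix t :: real
      have "0 \<le> 1 - f t" "1 - f t \<le> 1"
        using \<open>d > 0\<close> by (auto simp: f_def)
      then have "\<bar>t\<bar> * (1 - f t) * (1 - f t) \<le> \<bar>t\<bar> * (1 - f t)"
        by (simp add: mult_left_le)
      also have "\<dots> \<le> d"
      proof (cases "\<bar>t\<bar> \<le> d")
        case True
        with \<open>1 - f t \<le> 1\<close> show ?thesis
          using mult_left_le[of "1 - f t" "\<bar>t\<bar>"] by simp
      next
        case False
        with \<open>d > 0\<close> show ?thesis by (simp add: f_def)
      qed
      finally have "\<bar>t\<bar> * (1 - f t) * (1 - f t) \<le> d" .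
      moreover have "g t = t * (1 - f t) * (1 - f t)"
        by (simp add: g_def algebra_simps)
      then have "\<bar>t\<bar> * (1 - f t) * (1 - f t) = \<bar>g t\<bar>"
        using \<open>0 \<le> 1 - f t\<close> by (simp add: abs_mult)
      ultimately show "\<bar>g t\<bar> \<le> d" by simp
    qed
    finally have "norm (x - x * p) \<le> e / 2"
      using \<open>0 < e\<close> by (simp add: d_def)
    moreover have "x * p = commutator x p"
      by (simp add: commutator_def p(2))
    then have "x * p \<in> commutator_span"
      unfolding commutator_span_def by (auto intro!: complex_vector.span_base)
    ultimately show "\<exists>y\<in>commutator_span. dist y x < e"
      using \<open>0 < e\<close> by (intro bexI[of _ "x * p"]) (auto simp: dist_norm norm_minus_commute)
  qed
qed

lemma square_zero_in_closure_commutator_span: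
  fixes x :: "'a::cstar_algebra"
  assumes "x * x = 0"
  shows "x \<in> closure commutator_span"
proof -
  obtain r where r: "r > 0" "norm (r *\<^sub>R x) \<le> 1/2" by (rule small_multiple)
  have "r *\<^sub>R x \<in> closure commutator_span"
    by (rule small_square_zero_in_closure_commutator_span) (use assms r in simp_all)
  then have "(1 / r) *\<^sub>R r *\<^sub>R x \<in> closure commutator_span"
    by (rule csubspace_scaleR[OF csubspace_closure, rotated]) (simp add: commutator_span_def)
  also have "(1 / r) *\<^sub>R r *\<^sub>R x = x" using r(1) by simp
  finally show ?thesis .
qed

section \<open>Commutators are limits of sums of square-zero elements\<close>

abbreviation square_zero_space :: "'a::cstar_algebra set"
  where "square_zero_space \<equiv> closure (cspan nilpotents2)"

lemma csubspace_square_zero_space: "csubspace square_zero_space"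
  by (rule csubspace_closure[OF complex_vector.subspace_span])

lemma square_zero_in: "x * x = 0 \<Longrightarrow> x \<in> square_zero_space"
proof -
  assume x: "x * x = 0"
  have "x \<in> cspan nilpotents2"
  proof (cases "x = 0")
    case True
    show ?thesis unfolding True by (rule complex_vector.span_zero)
  next
    case False
    with x have "x \<in> nilpotents2" by (simp only: nilpotents2_def mem_Collect_eq simp_thms)
    then show ?thesis by (rule complex_vector.span_base)
  qed
  then show ?thesis by (rule set_mp[OF closure_subset])
qed

text \<open>
  Averaging the products over all signs cancels the mixed terms \<open>a\<^sub>i y b\<^sub>j\<close>. The sum over \<open>J\<close> therefore
  inherits a bound that is uniform in the signs and does not grow with the number of terms. The
  summands \<open>u\<close> and \<open>v\<close> collect the indices whose sign has already been averaged.
\<close>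

lemma norm_sum_products_le_signed:
  fixes a b :: "'i \<Rightarrow> 'a::real_normed_algebra"
  assumes "finite J"
    and "\<And>\<epsilon> :: 'i \<Rightarrow> real. (\<And>j. \<bar>\<epsilon> j\<bar> = 1) \<Longrightarrow>
      norm ((u + (\<Sum>j\<in>J. \<epsilon> j *\<^sub>R a j)) * y * (v + (\<Sum>j\<in>J. \<epsilon> j *\<^sub>R b j))) \<le> M"
  shows "norm (u * y * v + (\<Sum>j\<in>J. a j * y * b j)) \<le> M"
  using assms
proof (induction J arbitrary: u v rule: finite_induct)
  case empty
  from empty[of "\<lambda>_. 1"] show ?case by simp
next
  case (insert k J)
  have IH: "norm ((u + s *\<^sub>R a k) * y * (v + s *\<^sub>R b k) + (\<Sum>j\<in>J. a j * y * b j)) \<le> M"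
    if s: "\<bar>s\<bar> = 1" for s :: real
  proof (rule insert.IH)
    fix \<epsilon> :: "'i \<Rightarrow> real" assume "\<And>j. \<bar>\<epsilon> j\<bar> = 1"
    then have "\<bar>(\<epsilon>(k := s)) j\<bar> = 1" for j using s by simp
    note insert.prems[of "\<epsilon>(k := s)", OF this]
    moreover have "(\<Sum>j\<in>insert k J. (\<epsilon>(k := s)) j *\<^sub>R f j) = s *\<^sub>R f k + (\<Sum>j\<in>J. \<epsilon> j *\<^sub>R f j)"
      for f :: "'i \<Rightarrow> 'a"
      using insert.hyps by (simp add: sum.insert) (intro sum.cong; auto)
    ultimately show "norm ((u + s *\<^sub>R a k + (\<Sum>j\<in>J. \<epsilon> j *\<^sub>R a j)) * y
        * (v + s *\<^sub>R b k + (\<Sum>j\<in>J. \<epsilon> j *\<^sub>R b j))) \<le> M"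
      by (simp only: add.assoc)
  qed
  define T where "T = (\<Sum>j\<in>J. a j * y * b j)"
  have "2 *\<^sub>R (u * y * v + (a k * y * b k + T))
      = ((u + 1 *\<^sub>R a k) * y * (v + 1 *\<^sub>R b k) + T)
      + ((u + (-1) *\<^sub>R a k) * y * (v + (-1) *\<^sub>R b k) + T)"
    by (simp add: algebra_simps scaleR_2)
  also have "norm \<dots> \<le> M + M"
    unfolding T_def by (intro order_trans[OF norm_triangle_ineq] add_mono IH) simp_all
  finally have "norm (u * y * v + (a k * y * b k + T)) \<le> M" by simp
  then show ?case using insert.hyps by (simp add: T_def)
qed

definition tent :: "nat \<Rightarrow> int \<Rightarrow> real \<Rightarrow> real"
  where "tent n j t = max 0 (1 - \<bar>real n * t - of_int j\<bar>)"

text \<open>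
  At each point at most two neighbouring tents are non-zero, and their values are \<open>1 - x\<close> and \<open>x\<close>.
  All identities and estimates for sums of tents reduce to convex combinations of two weights. The
  range of indices ends at \<open>n + 1\<close> so that it contains both neighbours also for \<open>t = 1\<close>.
\<close>

lemma tent_sum:
  assumes "t \<in> {-1..1}"
  obtains k x where "0 \<le> x" "x \<le> 1" "real n * t = of_int k + x"
    "\<And>w. (\<Sum>j\<in>{- int n..int n + 1}. w j * tent n j t) = w k * (1 - x) + w (k + 1) * x"
proof
  define k where "k = \<lfloor>real n * t\<rfloor>"
  define x where "x = frac (real n * t)"
  show x: "0 \<le> x" "x \<le> 1" and eq: "real n * t = of_int k + x"
    by (simp_all add: x_def k_def frac_ge_0 less_imp_le[OF frac_lt_1]) (simp add: frac_def)
  have "real n * t \<le> real n * 1" "real n * (-1) \<le> real n * t"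
    using assms by (intro mult_left_mono; simp)+
  then have k: "k \<le> int n" "- int n \<le> k"
    unfolding k_def by (simp_all add: floor_le_iff le_floor_iff)
  fix w :: "int \<Rightarrow> real"
  have "(\<Sum>j\<in>{- int n..int n + 1}. w j * tent n j t) = (\<Sum>j\<in>{k, k + 1}. w j * tent n j t)"
  proof (rule sum.mono_neutral_right)
    show "\<forall>j\<in>{- int n..int n + 1} - {k, k + 1}. w j * tent n j t = 0"
    proof
      fix j assume "j \<in> {- int n..int n + 1} - {k, k + 1}"
      then have "j + 1 \<le> k \<or> k + 2 \<le> j" by auto
      then have "of_int j + 1 \<le> (of_int k :: real) \<or> of_int k + 2 \<le> (of_int j :: real)"
        by linarith
      then show "w j * tent n j t = 0"
        using x eq by (auto simp: tent_def)
    qed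
  qed (use k in auto)
  also have "\<dots> = w k * (1 - x) + w (k + 1) * x"
    using x eq by (simp add: tent_def max_def)
  finally show "(\<Sum>j\<in>{- int n..int n + 1}. w j * tent n j t) = w k * (1 - x) + w (k + 1) * x" .
qed

lemma tent_mult_eq_0:
  assumes "2 \<le> \<bar>j - k\<bar>"
  shows "tent n j t * tent n k t = 0"
proof -
  have "2 \<le> \<bar>of_int j - of_int k :: real\<bar>" using assms by linarith
  then show ?thesis by (auto simp: tent_def max_def)
qed

lemma tent_in_calc_functions: "j \<noteq> 0 \<Longrightarrow> tent n j \<in> calc_functions"
  by (auto simp: tent_def[abs_def] calc_functions_def intro!: continuous_intros)

context small_selfadjoint
begin

text \<open>
  The scaled element \<open>n h\<close> is replaced by a combination \<open>k\<close> of tents at distance at most 1. The tent at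
  0 does not vanish at 0 and has to be left out, so the remaining tents \<open>a j\<close> do not sum to a unit.
  The weights of \<open>k\<close> vanish for \<open>\<bar>j\<bar> \<le> 1\<close>, hence the sum \<open>g\<close> of the tents is still a unit for \<open>k\<close>, and
  this suffices: \<open>(y - g y) k\<close> and \<open>k (y - y g)\<close> have square zero, and modulo these the commutator of
  \<open>y\<close> and \<open>k\<close> is \<open>g y k - k y g\<close>, which is a double sum over tents.
\<close>

lemma commutator_near_square_zero_space:
  obtains l where "l \<in> square_zero_space" "norm (real n *\<^sub>R commutator y h - l) \<le> 8 * norm y"
proof -
  let ?N = "{- int n..int n + 1}"
  define J where "J = ?N - {0}"
  define a where "a j = calc (tent n j)" for j
  define c where "c j = (if \<bar>j\<bar> \<le> 1 then 0 else of_int j :: real)" for j :: int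
  have J: "finite J" "\<And>j. j \<in> J \<Longrightarrow> tent n j \<in> calc_functions"
    by (auto simp: J_def tent_in_calc_functions)
  define F where "F w t = (\<Sum>j\<in>J. w j * tent n j t)" for w t
  have F_in: "F w \<in> calc_functions" for w
    unfolding F_def by (intro calc_functions_sum calc_functions_scaleR J)
  have calc_F: "calc (F w) = (\<Sum>j\<in>J. w j *\<^sub>R a j)" for w
    unfolding F_def a_def by (rule calc_sum[OF J(2)])
  have F_eq: "F w t = (\<Sum>j\<in>?N. (w(0 := 0)) j * tent n j t)" for w t
    unfolding F_def J_def by (intro sum.mono_neutral_cong_left) auto
  have norm_F: "norm (\<Sum>j\<in>J. w j *\<^sub>R a j) \<le> M" if w: "\<And>j. j \<in> J \<Longrightarrow> \<bar>w j\<bar> \<le> M" and "0 \<le> M" for w M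
    unfolding calc_F[symmetric]
  proof (rule norm_calc_le[OF F_in])
    fix t :: real assume t: "t \<in> {-1..1}"
    have "\<bar>F w t\<bar> \<le> (\<Sum>j\<in>J. \<bar>w j * tent n j t\<bar>)"
      unfolding F_def by (rule sum_abs)
    also have "\<dots> \<le> (\<Sum>j\<in>J. M * tent n j t)"
      using w by (intro sum_mono) (auto simp: abs_mult tent_def intro!: mult_right_mono)
    also have "\<dots> \<le> (\<Sum>j\<in>?N. M * tent n j t)"
      unfolding J_def using \<open>0 \<le> M\<close> by (intro sum_mono2) (auto simp: tent_def)
    also have "\<dots> = M"
    proof (rule tent_sum[OF t, of n])
      fix i x
      assume "\<And>w. (\<Sum>j\<in>?N. w j * tent n j t) = w i * (1 - x) + w (i + 1) * x"
      from this[of "\<lambda>_. M"] show ?thesis by (simp add: algebra_simps)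
    qed
    finally show "\<bar>F w t\<bar> \<le> M" .
  qed
  define g where "g = (\<Sum>j\<in>J. 1 *\<^sub>R a j)"
  define k where "k = (\<Sum>j\<in>J. c j *\<^sub>R a j)"
  \<comment> \<open>If one of the two tents that are non-zero at \<open>t\<close> has index 0, then the other has index 1 or -1,
    and \<open>F c\<close> vanishes at \<open>t\<close>. Otherwise the weights 1 of the two tents add up to 1.\<close>
  have FF: "F c t * F (\<lambda>_. 1) t = F c t" "\<bar>real n * t - F c t\<bar> \<le> 1" if t: "t \<in> {-1..1}" for t
  proof -
    obtain i x where x: "0 \<le> x" "x \<le> 1" "real n * t = of_int i + x"
      and sum: "\<And>w. (\<Sum>j\<in>?N. w j * tent n j t) = w i * (1 - x) + w (i + 1) * x"
      by (rule tent_sum[OF t, of n]) (rule that)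
    have Fc: "F c t = c i * (1 - x) + c (i + 1) * x"
      unfolding F_eq sum by (auto simp: c_def)
    show "F c t * F (\<lambda>_. 1) t = F c t"
      unfolding F_eq sum by (auto simp: c_def)
    have ci: "\<bar>of_int j - c j\<bar> \<le> 1" for j by (auto simp: c_def)
    have "real n * t - F c t = (of_int i - c i) * (1 - x) + (of_int (i + 1) - c (i + 1)) * x"
      unfolding Fc x(3) by (simp add: algebra_simps)
    also have "\<bar>\<dots>\<bar> \<le> 1 * (1 - x) + 1 * x"
    proof -
      have "\<bar>(of_int i - c i) * (1 - x)\<bar> \<le> 1 * (1 - x)"
        "\<bar>(of_int (i + 1) - c (i + 1)) * x\<bar> \<le> 1 * x"
        unfolding abs_mult by (intro mult_mono ci; use x in simp)+
      then show ?thesis by linarith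
    qed
    finally show "\<bar>real n * t - F c t\<bar> \<le> 1" by simp
  qed
  have kg: "k * g = k" "g * k = k"
  proof -
    have "calc (\<lambda>t. F c t * F (\<lambda>_. 1) t) = calc (F c)" "calc (\<lambda>t. F (\<lambda>_. 1) t * F c t) = calc (F c)"
      using FF(1) by (intro calc_cong calc_functions_mult F_in; simp add: mult.commute)+
    then show "k * g = k" "g * k = k"
      by (simp_all only: calc_mult F_in k_def g_def calc_F)
  qed
  have hk: "norm (real n *\<^sub>R h - k) \<le> 1"
  proof -
    have "norm (calc (\<lambda>t. real n * t - F c t)) \<le> 1"
      by (intro norm_calc_le FF(2) calc_functions_diff calc_functions_scaleR calc_functions_ident F_in)
    then show ?thesis
      by (simp add: calc_diff calc_scaleR calc_functions_scaleR calc_functions_ident F_in calc_ident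
          calc_F k_def)
  qed
  have aa: "a i * a j = 0" if "i \<in> J" "j \<in> J" "2 \<le> \<bar>i - j\<bar>" for i j
    using that J(2) by (simp add: a_def tent_mult_eq_0 calc_zero flip: calc_mult)

  define near where "near j = {i \<in> J. \<bar>i - j\<bar> \<le> 1}" for j
  define b where "b j = (\<Sum>i\<in>near j. (c i - c j) *\<^sub>R a i)" for j
  define far where "far = (\<Sum>j\<in>J. \<Sum>i\<in>J - near j. (c i - c j) *\<^sub>R (a j * y * a i))"
  have split: "g * y * k - k * y * g = far + (\<Sum>j\<in>J. a j * y * b j)"
  proof -
    have "g * y * k - k * y * g = (\<Sum>j\<in>J. \<Sum>i\<in>J. (c i - c j) *\<^sub>R (a j * y * a i))"
    proof -
      have "g * y * k = (\<Sum>j\<in>J. \<Sum>i\<in>J. c i *\<^sub>R (a j * y * a i))"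
        "k * y * g = (\<Sum>j\<in>J. \<Sum>i\<in>J. c j *\<^sub>R (a j * y * a i))"
        by (simp_all only: g_def k_def sum_distrib_right) (simp_all add: sum_distrib_left)
      then show ?thesis by (simp only: scaleR_left_diff_distrib sum_subtractf)
    qed
    also have "\<dots> = far + (\<Sum>j\<in>J. \<Sum>i\<in>near j. (c i - c j) *\<^sub>R (a j * y * a i))"
      unfolding far_def sum.distrib[symmetric]
      using J(1) by (intro sum.cong refl sum.subset_diff) (auto simp: near_def)
    finally show ?thesis
      by (simp add: b_def sum_distrib_left)
  qed
  have far: "far \<in> square_zero_space"
    unfolding far_def
  proof (intro complex_vector.subspace_sum csubspace_square_zero_space csubspace_scaleR square_zero_in)
    fix j i assume "j \<in> J" "i \<in> J - near j"
    then have "a i * a j = 0" by (intro aa) (auto simp: near_def)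
    have "a j * y * a i * (a j * y * a i) = a j * y * (a i * a j) * y * a i"
      by (simp only: mult.assoc)
    with \<open>a i * a j = 0\<close> show "a j * y * a i * (a j * y * a i) = 0" by simp
  qed
  \<comment> \<open>Each \<open>b j\<close> involves only neighbours of \<open>j\<close>, so signed sums of the \<open>b j\<close> are again combinations of
    tents with weights bounded independently of \<open>n\<close>.\<close>
  have rest: "norm (\<Sum>j\<in>J. a j * y * b j) \<le> 6 * norm y"
  proof -
    have "norm (0 * y * 0 + (\<Sum>j\<in>J. a j * y * b j)) \<le> 1 * norm y * 6"
    proof (rule norm_sum_products_le_signed[OF J(1)])
      fix \<epsilon> :: "int \<Rightarrow> real" assume \<epsilon>: "\<And>j. \<bar>\<epsilon> j\<bar> = 1"
      have A: "norm (\<Sum>j\<in>J. \<epsilon> j *\<^sub>R a j) \<le> 1"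
        by (rule norm_F) (simp_all add: \<epsilon>)
      have "(\<Sum>j\<in>J. \<epsilon> j *\<^sub>R b j) = (\<Sum>j\<in>J. \<Sum>i\<in>near j. (\<epsilon> j * (c i - c j)) *\<^sub>R a i)"
        by (simp add: b_def scaleR_sum_right)
      also have "\<dots> = (\<Sum>i\<in>J. \<Sum>j\<in>near i. (\<epsilon> j * (c i - c j)) *\<^sub>R a i)"
        unfolding near_def
        by (subst sum.swap_restrict[OF J(1) J(1)]) (simp add: abs_minus_commute)
      also have "\<dots> = (\<Sum>i\<in>J. (\<Sum>j\<in>near i. \<epsilon> j * (c i - c j)) *\<^sub>R a i)"
        by (simp add: scaleR_sum_left)
      also have "norm \<dots> \<le> 6"
      proof (rule norm_F)
        fix i
        have "\<bar>\<Sum>j\<in>near i. \<epsilon> j * (c i - c j)\<bar> \<le> (\<Sum>j\<in>near i. \<bar>\<epsilon> j * (c i - c j)\<bar>)"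
          by (rule sum_abs)
        also have "\<dots> \<le> (\<Sum>j\<in>near i. 2)"
        proof (rule sum_mono)
          fix j assume "j \<in> near i"
          then have "\<bar>c i - c j\<bar> \<le> 2" by (auto simp: near_def c_def abs_le_iff)
          then show "\<bar>\<epsilon> j * (c i - c j)\<bar> \<le> 2" by (simp add: abs_mult \<epsilon>)
        qed
        \<comment> \<open>Each index has at most three neighbours, itself included.\<close>
        also have "\<dots> \<le> (\<Sum>j\<in>{i - 1..i + 1}. 2)"
          by (rule sum_mono2) (auto simp: near_def)
        finally show "\<bar>\<Sum>j\<in>near i. \<epsilon> j * (c i - c j)\<bar> \<le> 6" by simp
      qed simp
      finally have B: "norm (\<Sum>j\<in>J. \<epsilon> j *\<^sub>R b j) \<le> 6" .
      have "norm ((\<Sum>j\<in>J. \<epsilon> j *\<^sub>R a j) * y * (\<Sum>j\<in>J. \<epsilon> j *\<^sub>R b j))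
          \<le> norm (\<Sum>j\<in>J. \<epsilon> j *\<^sub>R a j) * norm y * norm (\<Sum>j\<in>J. \<epsilon> j *\<^sub>R b j)"
        by (intro order_trans[OF norm_mult_ineq] mult_right_mono norm_mult_ineq) simp
      also have "\<dots> \<le> 1 * norm y * 6"
        by (intro mult_mono A B) simp_all
      finally show "norm ((0 + (\<Sum>j\<in>J. \<epsilon> j *\<^sub>R a j)) * y * (0 + (\<Sum>j\<in>J. \<epsilon> j *\<^sub>R b j)))
          \<le> 1 * norm y * 6"
        by simp
    qed
    then show ?thesis by simp
  qed
  define l where "l = (y - g * y) * k - k * (y - y * g) + far"
  show ?thesis
  proof
    have "(y - g * y) * k * ((y - g * y) * k) = (y - g * y) * (k * y - k * g * y) * k"
      "k * (y - y * g) * (k * (y - y * g)) = k * (y * k - y * (g * k)) * (y - y * g)"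
      by (simp_all add: algebra_simps)
    then have "(y - g * y) * k * ((y - g * y) * k) = 0" "k * (y - y * g) * (k * (y - y * g)) = 0"
      by (simp_all add: kg)
    then show "l \<in> square_zero_space"
      unfolding l_def
      by (intro complex_vector.subspace_add complex_vector.subspace_diff csubspace_square_zero_space
          square_zero_in far)
    have "commutator y k - l = g * y * k - k * y * g - far"
      by (simp add: commutator_def l_def algebra_simps)
    then have 1: "norm (commutator y k - l) \<le> 6 * norm y"
      using rest by (simp add: split)
    define w where "w = real n *\<^sub>R h - k"
    have "norm (y * w) \<le> norm y * 1" "norm (w * y) \<le> 1 * norm y"
      using hk by (intro order_trans[OF norm_mult_ineq] mult_mono; simp add: w_def)+
    then have 2: "norm (y * w - w * y) \<le> norm y + norm y"
      using norm_triangle_ineq4[of "y * w" "w * y"] by simp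
    have "real n *\<^sub>R commutator y h - l = (commutator y k - l) + (y * w - w * y)"
      by (simp add: commutator_def w_def algebra_simps)
    also have "norm \<dots> \<le> 6 * norm y + (norm y + norm y)"
      by (intro order_trans[OF norm_triangle_ineq] add_mono 1 2)
    finally show "norm (real n *\<^sub>R commutator y h - l) \<le> 8 * norm y" by simp
  qed
qed

lemma commutator_in_square_zero_space: "commutator y h \<in> square_zero_space"
proof -
  have "commutator y h \<in> closure square_zero_space"
  proof (subst closure_approachable, intro allI impI)
    fix e :: real assume "0 < e"
    obtain n :: nat where n: "8 * norm y / e < real n" using reals_Archimedean2 by blast
    moreover have "0 \<le> 8 * norm y / e" using \<open>0 < e\<close> by simp
    ultimately have "n > 0" by (metis of_nat_0_less_iff order_le_less_trans)
    obtain l where l: "l \<in> square_zero_space" "norm (real n *\<^sub>R commutator y h - l) \<le> 8 * norm y"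
      by (rule commutator_near_square_zero_space)
    have "commutator y h - (1 / real n) *\<^sub>R l = (1 / real n) *\<^sub>R (real n *\<^sub>R commutator y h - l)"
      using \<open>n > 0\<close> by (simp add: scaleR_right_diff_distrib)
    then have "norm (commutator y h - (1 / real n) *\<^sub>R l) \<le> 8 * norm y / real n"
      using l(2) \<open>n > 0\<close> by (simp add: divide_right_mono)
    also have "\<dots> < e" using n \<open>n > 0\<close> \<open>0 < e\<close> by (simp add: field_simps)
    finally show "\<exists>x\<in>square_zero_space. dist x (commutator y h) < e"
      using csubspace_scaleR[OF csubspace_square_zero_space l(1)]
      by (intro bexI[of _ "(1 / real n) *\<^sub>R l"]) (simp_all add: dist_norm norm_minus_commute)
  qed
  then show ?thesis by simp
qed

end

lemma commutator_in_square_zero_space: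
  fixes x y :: "'a::cstar_algebra"
  shows "commutator y x \<in> square_zero_space"
proof -
  have sa: "commutator y h \<in> square_zero_space" if "star h = h" for h :: 'a
  proof -
    obtain r where r: "r > 0" "norm (r *\<^sub>R h) \<le> 1/2" by (rule small_multiple)
    then interpret small_selfadjoint "r *\<^sub>R h"
      using that by unfold_locales simp_all
    have "commutator y h = (1 / r) *\<^sub>R commutator y (r *\<^sub>R h)"
      using r by (simp add: commutator_def scaleR_right_diff_distrib)
    then show ?thesis
      using csubspace_scaleR[OF csubspace_square_zero_space commutator_in_square_zero_space] by simp
  qed
  define h k where "h = (1/2) *\<^sub>R (x + star x)" and "k = (- \<i> / 2) *\<^sub>C (x - star x)"
  have "star h = h" "star k = k"
    by (simp_all add: h_def k_def star_add star_star star_scaleC add.commute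
        complex_vector.scale_right_diff_distrib)
  then have "commutator y h + \<i> *\<^sub>C commutator y k \<in> square_zero_space"
    by (intro complex_vector.subspace_add complex_vector.subspace_scale csubspace_square_zero_space sa)
  moreover have "x = h + \<i> *\<^sub>C k"
  proof -
    have "\<i> *\<^sub>C k = (1/2) *\<^sub>R (x - star x)"
      by (simp add: k_def scaleC_scaleC scaleR_scaleC)
    then have "h + \<i> *\<^sub>C k = (1/2) *\<^sub>R (x + x)"
      by (simp add: h_def flip: scaleR_right_distrib)
    then show ?thesis by simp
  qed
  then have "commutator y x = commutator y h + \<i> *\<^sub>C commutator y k"
    by (simp add: commutator_def algebra_simps mult_scaleC_left mult_scaleC_right
        complex_vector.scale_right_diff_distrib)
  ultimately show ?thesis by simp
qed

theorem corollary2p3: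
  shows "closure (cspan (nilpotents2 :: 'a :: cstar_algebra set)) = closure (commutator_span :: 'a set)"
proof
  have "csubspace (closure (commutator_span :: 'a set))"
    unfolding commutator_span_def by (intro csubspace_closure complex_vector.subspace_span)
  then have "cspan (nilpotents2 :: 'a set) \<subseteq> closure commutator_span"
    by (intro complex_vector.span_minimal)
      (auto simp: nilpotents2_def intro: square_zero_in_closure_commutator_span)
  then show "closure (cspan nilpotents2) \<subseteq> closure (commutator_span :: 'a set)"
    by (simp add: closure_minimal)
  have "(commutator_span :: 'a set) \<subseteq> square_zero_space"
    unfolding commutator_span_def
    by (rule complex_vector.span_minimal)
      (auto intro: commutator_in_square_zero_space csubspace_square_zero_space)
  then show "closure (commutator_span :: 'a set) \<subseteq> closure (cspan nilpotents2)"
    by (simp add: closure_minimal)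
qed

end
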